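(* Let $\Gamma$ be an arbitrary directed graph on the node set $[k]$. Then a partition $E$ of $[k]$ is the equality partition of a face of the braid cone $Q(\Gamma,\mathbf 0)$ if and only if (i) for each part $K$ of $E$ the induced subgraph of $\Gamma$ on $K$ is weakly connected, and (ii) the minor of $\Gamma$ which results from simultaneously contracting each part of $E$ does not contain any directed cycle.
   Context: $[k]=\{1,\dots,k\}$. A directed graph $\Gamma$ on $[k]$ is identified with its set of arcs $(i,j)\in[k]\times[k]$. The braid cone of $\Gamma$ is $Q(\Gamma,\mathbf 0)=\{x\in\mathbb R^k : x_i\le x_j \text{ for all }(i,j)\in\Gamma\}$. Faces are the nonempty faces of this polyhedral cone, including the cone itself. The equality partition of a face $F$ is the partition of $[k]$ in which $i$ and $j$ lie in the same part if and only if $x_i=x_j$ for all $x\in F$. A directed graph is weakly connected if its underlying undirected graph is connected. In the contraction, the arcs having both endpoints in the same part are removed (they do not count as directed cycles). *)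

theory Defs
  imports "HOL-Analysis.Analysis" "Graph_Theory.Digraph_Component"
begin

text \<open>
  The node set is the whole finite type \<open>'k\<close>, so that the number of nodes is \<open>CARD('k)\<close> and
  \<open>real ^ 'k\<close> is the ambient space. A directed graph is its set of arcs; loops and antiparallel
  pairs of arcs are allowed.
\<close>

definition braid_cone :: "('k::finite) rel \<Rightarrow> (real ^ 'k) set" where
  "braid_cone \<Gamma> = {x. \<forall>(i, j) \<in> \<Gamma>. x $ i \<le> x $ j}"

definition equality_partition :: "(real ^ 'k::finite) set \<Rightarrow> 'k set set" where
  "equality_partition F = UNIV // {(i, j). \<forall>x\<in>F. x $ i = x $ j}"

definition arcs_digraph :: "('k::finite) rel \<Rightarrow> ('k, 'k \<times> 'k) pre_digraph" where
  "arcs_digraph \<Gamma> = with_proj \<lparr>pverts = UNIV, parcs = \<Gamma>\<rparr>"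

text \<open>
  The underlying undirected graph of \<open>G\<close> is represented by the symmetric digraph
  \<open>mk_symmetric G\<close>. The qualified name is needed because \<open>connected\<close> is also
  the topological notion.
\<close>

abbreviation weakly_connected :: "('a, 'b) pre_digraph \<Rightarrow> bool" where
  "weakly_connected G \<equiv> Digraph_Component.connected G"

text \<open>
  The nodes of the minor are the parts themselves. Parallel arcs are identified, which does not
  affect directed cycles; two opposite arcs between distinct parts form a directed cycle.
\<close>

definition contract_parts :: "('k::finite) rel \<Rightarrow> 'k set set \<Rightarrow> ('k set, 'k set \<times> 'k set) pre_digraph" where
  "contract_parts \<Gamma> E = with_proj
     \<lparr>pverts = E,
      parcs = {(A, B). A \<in> E \<and> B \<in> E \<and> A \<noteq> B \<and> (\<exists>i\<in>A. \<exists>j\<in>B. (i, j) \<in> \<Gamma>)}\<rparr>"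

end

theory Submission
  imports Defs
begin

text \<open>
  If \<open>x\<close> is a relative interior point of a face \<open>F\<close>, then \<open>x\<^sub>a < x\<^sub>b\<close> for every arc \<open>(a, b)\<close> between
  different parts of the equality partition. Were a part \<open>K\<close> disconnected, a component of \<open>K\<close>
  could be shifted by \<open>\<plusminus>\<epsilon>\<close> without leaving the cone; since \<open>F\<close> is a face, the shifted points lie
  in \<open>F\<close>, but they are not constant on \<open>K\<close>. A directed cycle of the minor would force equality along
  its parts.
  Conversely, take the points of the cone that are constant on every part. They form a face because
  the parts are connected, and the indicators of the up-sets generated by a single part
  in the acyclic minor separate any two parts.
\<close>

section \<open>Connectivity, acyclicity and the equality partition in elementary terms\<close>

text \<open>Membership in a set that no arc enters or leaves spreads along undirected walks;
  conversely, the nodes reached from \<open>u\<close> by such walks form a set of this kind.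
  Connectivity is used below only in this form: the set is once a set to be shifted, once a level
  set.\<close>

lemma (in wf_digraph) connected_iff_no_cut:
  "Digraph_Component.connected G \<longleftrightarrow>
    verts G \<noteq> {} \<and>
    (\<forall>S\<subseteq>verts G. S \<noteq> {} \<longrightarrow> (\<forall>e\<in>arcs G. tail G e \<in> S \<longleftrightarrow> head G e \<in> S) \<longrightarrow> S = verts G)"
  (is "_ \<longleftrightarrow> _ \<and> ?cuts")
proof
  assume con: "Digraph_Component.connected G"
  have "S = verts G" if S: "S \<subseteq> verts G" "S \<noteq> {}" and
    closed: "\<forall>e\<in>arcs G. tail G e \<in> S \<longleftrightarrow> head G e \<in> S" for S
  proof -
    obtain u where u: "u \<in> S" using S by blast
    have "v \<in> S" if "v \<in> verts G" for v
    proof -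
      have "(u, v) \<in> rtrancl_on (verts G) (parcs (mk_symmetric G))"
        using con u S that
        by (auto simp: Digraph_Component.connected_def strongly_connected_def reachable_def)
      then show "v \<in> S"
        by (induction rule: rtrancl_on_induct) (use u closed in \<open>auto simp: parcs_mk_symmetric\<close>)
    qed
    with S show ?thesis by blast
  qed
  with con show "verts G \<noteq> {} \<and> ?cuts"
    by (auto simp: Digraph_Component.connected_def strongly_connected_def)
next
  assume R: "verts G \<noteq> {} \<and> ?cuts"
  have "(u, v) \<in> rtrancl_on (verts G) (parcs (mk_symmetric G))"
    if u: "u \<in> verts G" and v: "v \<in> verts G" for u v
  proof -
    define S where "S = {w. (u, w) \<in> rtrancl_on (verts G) (parcs (mk_symmetric G))}"
    have "S \<subseteq> verts G" by (auto simp: S_def dest: in_rtrancl_on_in_F)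
    moreover have "S \<noteq> {}" using u by (auto simp: S_def)
    moreover have "tail G e \<in> S \<longleftrightarrow> head G e \<in> S" if e: "e \<in> arcs G" for e
    proof -
      have "(tail G e, head G e) \<in> parcs (mk_symmetric G)"
        and "(head G e, tail G e) \<in> parcs (mk_symmetric G)"
        using e by (auto simp: parcs_mk_symmetric)
      then show ?thesis
        using e unfolding S_def mem_Collect_eq
        by (blast intro: rtrancl_on_into_rtrancl_on tail_in_verts head_in_verts)
    qed
    ultimately have "S = verts G" using R by blast
    with v show ?thesis by (auto simp: S_def)
  qed
  with R show "Digraph_Component.connected G"
    by (auto simp: Digraph_Component.connected_def strongly_connected_def reachable_def)
qed

text \<open>A cycle is a nonempty closed walk, and every nonempty closed walk contains a cycle. A
  loop counts as a cycle on both sides.\<close>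

lemma (in wf_digraph) ex_cycle_iff_not_acyclic: "(\<exists>p. cycle p) \<longleftrightarrow> \<not> acyclic (arcs_ends G)"
proof
  assume "\<exists>p. cycle p"
  then show "\<not> acyclic (arcs_ends G)"
    unfolding cycle_def acyclic_def by (blast dest: reachable1_awalkI)
next
  assume "\<not> acyclic (arcs_ends G)"
  then show "\<exists>p. cycle p"
    unfolding acyclic_def reachable1_awalk
    by (metis closed_w_def closed_w_imp_cycle length_greater_0_conv)
qed

lemma weakly_connected_induce_iff:
  "weakly_connected (induce_subgraph (arcs_digraph \<Gamma>) K) \<longleftrightarrow>
    K \<noteq> {} \<and>
    (\<forall>S\<subseteq>K. S \<noteq> {} \<longrightarrow> (\<forall>(i, j)\<in>\<Gamma>. i \<in> K \<longrightarrow> j \<in> K \<longrightarrow> (i \<in> S \<longleftrightarrow> j \<in> S)) \<longrightarrow> S = K)"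
proof -
  interpret wf_digraph "induce_subgraph (arcs_digraph \<Gamma>) K"
    by unfold_locales (auto simp: induce_subgraph_def)
  show ?thesis
    unfolding connected_iff_no_cut
    by (simp add: induce_subgraph_def arcs_digraph_def Ball_def split_beta imp_conjL)
qed

lemma contract_parts_cycle_iff:
  "(\<exists>p. pre_digraph.cycle (contract_parts \<Gamma> E) p) \<longleftrightarrow>
    \<not> acyclic {(A, B). A \<in> E \<and> B \<in> E \<and> A \<noteq> B \<and> (\<exists>i\<in>A. \<exists>j\<in>B. (i, j) \<in> \<Gamma>)}"
proof -
  interpret wf_digraph "contract_parts \<Gamma> E"
    by unfold_locales (auto simp: contract_parts_def)
  show ?thesis
    unfolding ex_cycle_iff_not_acyclic by (simp add: contract_parts_def)
qed

text \<open>An equivalence relation and its quotient determine each other, so comparing two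
  partitions reduces to comparing pairs of nodes.\<close>

lemma equality_partition_eq_iff:
  assumes E: "partition_on UNIV E"
  shows "equality_partition F = E \<longleftrightarrow>
    (\<forall>i j. (\<forall>x\<in>F. x $ i = x $ j) \<longleftrightarrow> (\<exists>K\<in>E. i \<in> K \<and> j \<in> K))"
proof -
  define R where "R = {(i, j). \<forall>x\<in>F. x $ i = x $ j}"
  have R: "equiv UNIV R"
    by (auto simp: R_def equiv_def refl_on_def sym_def trans_def)
  show ?thesis
  proof
    assume "equality_partition F = E"
    then have Q: "E = UNIV // R" by (simp add: equality_partition_def R_def)
    have "(i, j) \<in> R \<longleftrightarrow> (\<exists>K\<in>E. i \<in> K \<and> j \<in> K)" for i j
    proof
      assume "(i, j) \<in> R"
      then show "\<exists>K\<in>E. i \<in> K \<and> j \<in> K"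
        unfolding Q using equiv_class_self[OF R, of i] by (auto intro!: bexI[of _ "R `` {i}"] quotientI)
    next
      assume "\<exists>K\<in>E. i \<in> K \<and> j \<in> K"
      then show "(i, j) \<in> R"
        unfolding Q using quotient_eq_iff[OF R] by blast
    qed
    then show "\<forall>i j. (\<forall>x\<in>F. x $ i = x $ j) \<longleftrightarrow> (\<exists>K\<in>E. i \<in> K \<and> j \<in> K)"
      by (simp add: R_def)
  next
    assume "\<forall>i j. (\<forall>x\<in>F. x $ i = x $ j) \<longleftrightarrow> (\<exists>K\<in>E. i \<in> K \<and> j \<in> K)"
    then have "equality_partition F = UNIV // {(i, j). \<exists>K\<in>E. i \<in> K \<and> j \<in> K}"
      by (simp add: equality_partition_def)
    also have "\<dots> = E" using partition_on_eq_quotient[OF E] .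
    finally show "equality_partition F = E" .
  qed
qed

section \<open>Convexity, and the conditions forced by a face\<close>

lemma convex_braid_cone: "convex (braid_cone \<Gamma>)"
  unfolding convex_def braid_cone_def
  by (auto intro!: add_mono mult_left_mono)

text \<open>The segment from \<open>y\<close> to \<open>x\<close> can be prolonged beyond
  \<open>x\<close> inside \<open>F\<close>. The slack of the arc is affine on this line and positive
  at \<open>y\<close>; if it vanished at \<open>x\<close>, it would be negative beyond.\<close>

lemma strict_at_rel_interior:
  assumes "convex F" "F \<subseteq> braid_cone \<Gamma>" and x: "x \<in> rel_interior F"
    and ab: "(a, b) \<in> \<Gamma>" and y: "y \<in> F" "y $ a \<noteq> y $ b"
  shows "x $ a < x $ b"
proof -
  obtain e where e: "e > 1" and z: "(1 - e) *\<^sub>R y + e *\<^sub>R x \<in> F"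
    using convex_rel_interior_iff[OF \<open>convex F\<close>] x y rel_interior_subset by blast
  have "y $ a < y $ b" using assms by (force simp: braid_cone_def)
  then have "(e - 1) * (y $ a) < (e - 1) * (y $ b)" using e by simp
  moreover have "(1 - e) * y $ a + e * x $ a \<le> (1 - e) * y $ b + e * x $ b"
    using z assms(2) ab by (force simp: braid_cone_def)
  ultimately have "e * x $ a < e * x $ b" by (simp add: algebra_simps)
  then show ?thesis using e by simp
qed

text \<open>A shift of \<open>S\<close> changes only the slack of arcs crossing the boundary of
  \<open>S\<close>. These are finitely many and have positive slack, so the least slack bounds an
  admissible shift.\<close>

lemma braid_cone_small_shift:
  assumes x: "x \<in> braid_cone \<Gamma>"
    and strict: "\<And>a b. (a, b) \<in> \<Gamma> \<Longrightarrow> (a \<in> S) \<noteq> (b \<in> S) \<Longrightarrow> x $ a < x $ b"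
  obtains \<epsilon> :: real where "\<epsilon> > 0"
    "x + (\<chi> i. if i \<in> S then \<epsilon> else 0) \<in> braid_cone \<Gamma>"
    "x - (\<chi> i. if i \<in> S then \<epsilon> else 0) \<in> braid_cone \<Gamma>"
proof -
  \<comment> \<open>The element 1 keeps \<open>D\<close> nonempty when no arc crosses the boundary
    of \<open>S\<close>.\<close>
  define D where "D = insert 1 ((\<lambda>(a, b). x $ b - x $ a) ` {(a, b) \<in> \<Gamma>. (a \<in> S) \<noteq> (b \<in> S)})"
  have D: "finite D" "D \<noteq> {}" by (auto simp: D_def)
  have pos: "Min D > 0" using D strict by (auto simp: D_def)
  have small: "Min D \<le> x $ b - x $ a" if "(a, b) \<in> \<Gamma>" "(a \<in> S) \<noteq> (b \<in> S)" for a b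
    by (rule Min_le) (use D that in \<open>force simp: D_def\<close>)+
  have mono: "x $ a \<le> x $ b" if "(a, b) \<in> \<Gamma>" for a b
    using x that by (auto simp: braid_cone_def)
  show ?thesis
  proof (rule that[OF pos])
    have "\<bar>(if b \<in> S then Min D else 0) - (if a \<in> S then Min D else 0)\<bar> \<le> x $ b - x $ a"
      if "(a, b) \<in> \<Gamma>" for a b
      using small[OF that] mono[OF that] pos by (cases "a \<in> S"; cases "b \<in> S") simp_all
    then have "x $ a + (if a \<in> S then Min D else 0) \<le> x $ b + (if b \<in> S then Min D else 0)"
      "x $ a - (if a \<in> S then Min D else 0) \<le> x $ b - (if b \<in> S then Min D else 0)"
      if "(a, b) \<in> \<Gamma>" for a b
      using that by (smt (verit))+
    then show "x + (\<chi> i. if i \<in> S then Min D else 0) \<in> braid_cone \<Gamma>"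
      "x - (\<chi> i. if i \<in> S then Min D else 0) \<in> braid_cone \<Gamma>"
      unfolding braid_cone_def by (auto split del: if_split)
  qed
qed

lemma face_part_connected:
  assumes F: "F face_of braid_cone \<Gamma>" "F \<noteq> {}" and E: "partition_on UNIV E"
    and eq: "equality_partition F = E" and K: "K \<in> E"
  shows "weakly_connected (induce_subgraph (arcs_digraph \<Gamma>) K)"
  unfolding weakly_connected_induce_iff
proof (intro conjI allI impI)
  show "K \<noteq> {}" using partition_onD3[OF E] K by blast
next
  fix S assume S: "S \<subseteq> K" "S \<noteq> {}"
    and closed: "\<forall>(i, j)\<in>\<Gamma>. i \<in> K \<longrightarrow> j \<in> K \<longrightarrow> (i \<in> S \<longleftrightarrow> j \<in> S)"
  have same: "(\<forall>x\<in>F. x $ i = x $ j) \<longleftrightarrow> (\<exists>K\<in>E. i \<in> K \<and> j \<in> K)" for i j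
    by (rule iffD1[OF equality_partition_eq_iff[OF E] eq, THEN spec, THEN spec])
  have disj: "A = B" if "A \<in> E" "B \<in> E" "i \<in> A" "i \<in> B" for A B i
    using partition_onD2[OF E] that by (auto simp: disjoint_def)
  have conv: "convex F" and sub: "F \<subseteq> braid_cone \<Gamma>" using F by (auto simp: face_of_def)
  \<comment> \<open>Such a point exists because \<open>F\<close> is convex and nonempty.\<close>
  obtain x where x: "x \<in> rel_interior F"
    using F conv rel_interior_eq_empty by blast
  then have xF: "x \<in> F" using rel_interior_subset by blast
  have strict: "x $ a < x $ b" if ab: "(a, b) \<in> \<Gamma>" "(a \<in> S) \<noteq> (b \<in> S)" for a b
  proof -
    \<comment> \<open>No arc inside \<open>K\<close> crosses the boundary of \<open>S\<close>, but a
      crossing arc meets \<open>K\<close> because S \<subseteq> K. So its ends lie in different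
      parts, and some point of \<open>F\<close> separates them.\<close>
    have "\<not> (a \<in> K \<and> b \<in> K)" using ab closed by blast
    moreover have "a \<in> K \<or> b \<in> K" using ab(2) S by blast
    ultimately have "\<not> (\<exists>K\<in>E. a \<in> K \<and> b \<in> K)" using K disj by metis
    then obtain y where "y \<in> F" "y $ a \<noteq> y $ b" using same[of a b] by blast
    then show ?thesis by (rule strict_at_rel_interior[OF conv sub x ab(1)])
  qed
  obtain \<epsilon> :: real where \<epsilon>: "\<epsilon> > 0"
    and u: "x + (\<chi> i. if i \<in> S then \<epsilon> else 0) \<in> braid_cone \<Gamma>" (is "x + ?d \<in> _")
    and v: "x - (\<chi> i. if i \<in> S then \<epsilon> else 0) \<in> braid_cone \<Gamma>"
    using braid_cone_small_shift[of x \<Gamma> S] strict xF sub by blast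
  have "x + ?d \<noteq> x - ?d" using S \<epsilon> by (auto simp: vec_eq_iff)
  moreover have "midpoint (x + ?d) (x - ?d) = x"
    by (simp add: midpoint_def scaleR_2[symmetric])
  \<comment> \<open>As \<open>x\<close> is the midpoint of two distinct points of the cone, the face
    property puts both into \<open>F\<close>.\<close>
  ultimately have "x \<in> open_segment (x + ?d) (x - ?d)"
    by (metis midpoint_in_open_segment)
  then have uF: "x + ?d \<in> F" using face_ofD[OF F(1)] u v xF by blast
  show "S = K"
  proof (rule ccontr)
    \<comment> \<open>The shift moves coordinate \<open>s\<close> but not \<open>t\<close>, although
      all points of \<open>F\<close> agree on these two nodes of \<open>K\<close>.\<close>
    assume "S \<noteq> K"
    then obtain s t where st: "s \<in> S" "t \<in> K" "t \<notin> S" using S by blast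
    then have "\<exists>K\<in>E. s \<in> K \<and> t \<in> K" using S K by blast
    then have "\<forall>x\<in>F. x $ s = x $ t" using same[of s t] by blast
    from bspec[OF this xF] bspec[OF this uF]
    have "x $ s = x $ t" "(x + ?d) $ s = (x + ?d) $ t" .
    then show False using st \<epsilon> by simp
  qed
qed

text \<open>A point of \<open>F\<close> has one value on each part, and these values weakly increase
  along arcs of the minor. Around a cycle they coincide for every point of \<open>F\<close>, so
  distinct parts would have to be one.\<close>

lemma face_contraction_acyclic:
  assumes F: "F face_of braid_cone \<Gamma>" and E: "partition_on UNIV E"
    and eq: "equality_partition F = E"
  shows "acyclic {(A, B). A \<in> E \<and> B \<in> E \<and> A \<noteq> B \<and> (\<exists>i\<in>A. \<exists>j\<in>B. (i, j) \<in> \<Gamma>)}"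
proof -
  define R where "R = {(A, B). A \<in> E \<and> B \<in> E \<and> A \<noteq> B \<and> (\<exists>i\<in>A. \<exists>j\<in>B. (i, j) \<in> \<Gamma>)}"
  have same: "(\<forall>x\<in>F. x $ i = x $ j) \<longleftrightarrow> (\<exists>K\<in>E. i \<in> K \<and> j \<in> K)" for i j
    by (rule iffD1[OF equality_partition_eq_iff[OF E] eq, THEN spec, THEN spec])
  have disj: "A = B" if "A \<in> E" "B \<in> E" "i \<in> A" "i \<in> B" for A B i
    using partition_onD2[OF E] that by (auto simp: disjoint_def)
  have eq_on: "x $ i = x $ j" if "x \<in> F" "K \<in> E" "i \<in> K" "j \<in> K" for x K i j
    using same[of i j] that by blast
  have le_step: "x $ i \<le> x $ j" if "x \<in> F" and CD: "(C, D) \<in> R" and "i \<in> C" "j \<in> D" for x i j C D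
  proof -
    obtain i' j' where "i' \<in> C" "j' \<in> D" "(i', j') \<in> \<Gamma>"
      using CD by (auto simp: R_def)
    moreover have "x $ i = x $ i'" "x $ j = x $ j'"
      using eq_on[OF \<open>x \<in> F\<close>] that calculation by (auto simp: R_def)
    moreover have "x \<in> braid_cone \<Gamma>" using F that by (auto simp: face_of_def)
    ultimately show ?thesis by (auto simp: braid_cone_def)
  qed
  have steps: "\<forall>i\<in>C. \<forall>j\<in>D. x $ i \<le> x $ j" if "(C, D) \<in> R\<^sup>*" "C \<in> E" "x \<in> F" for x C D
    using that
  proof (induction rule: rtrancl_induct)
    case base
    then show ?case using eq_on by (metis order_refl)
  next
    case (step D D')
    \<comment> \<open>As the source of an arc, \<open>D\<close> has a node to pass through.\<close>
    then obtain d where d: "d \<in> D" by (auto simp: R_def)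
    show ?case
    proof (intro ballI)
      fix i j assume "i \<in> C" "j \<in> D'"
      then have "x $ i \<le> x $ d" "x $ d \<le> x $ j" using step d le_step by blast+
      then show "x $ i \<le> x $ j" by (rule order_trans)
    qed
  qed
  have "(A, A) \<notin> R\<^sup>+" for A
  proof
    assume "(A, A) \<in> R\<^sup>+"
    \<comment> \<open>Splitting off the first arc yields a part \<open>B\<close> different from
      \<open>A\<close>, since \<open>R\<close> has no loops; the rest of the walk gives the reverse
      inequality.\<close>
    then obtain B where AB: "(A, B) \<in> R" and BA: "(B, A) \<in> R\<^sup>*"
      by (blast dest: tranclD)
    obtain i j where ij: "i \<in> A" "j \<in> B" and AB': "A \<in> E" "B \<in> E" "A \<noteq> B"
      using AB by (auto simp: R_def)
    have "x $ i = x $ j" if "x \<in> F" for x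
      using le_step[OF that AB ij] steps[OF BA AB'(2) that] ij by force
    then obtain K where "K \<in> E" "i \<in> K" "j \<in> K" using same[of i j] by blast
    then show False using disj ij AB' by blast
  qed
  then show ?thesis unfolding R_def[symmetric] by (intro acyclicI allI)
qed

section \<open>The face belonging to a partition\<close>

text \<open>At a point inside a segment of the cone, the slack of an arc is a positive combination
  of the nonnegative slacks at the ends. If it vanishes, so do these; connectivity carries the
  resulting equalities from arcs to whole parts.\<close>

lemma constant_on_parts_face:
  assumes con: "\<And>K. K \<in> E \<Longrightarrow> weakly_connected (induce_subgraph (arcs_digraph \<Gamma>) K)"
  shows "{x \<in> braid_cone \<Gamma>. \<forall>K\<in>E. \<forall>i\<in>K. \<forall>j\<in>K. x $ i = x $ j} face_of braid_cone \<Gamma>"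
    (is "?F face_of _")
  unfolding face_of_def
proof (intro conjI ballI impI)
  show "?F \<subseteq> braid_cone \<Gamma>" by blast
  have "?F = braid_cone \<Gamma> \<inter> {x. \<forall>K\<in>E. \<forall>i\<in>K. \<forall>j\<in>K. x $ i = x $ j}" by blast
  moreover have "convex {x :: real^'a. \<forall>K\<in>E. \<forall>i\<in>K. \<forall>j\<in>K. x $ i = x $ j}"
  proof (unfold convex_def, intro ballI allI impI CollectI)
    fix x y :: "real^'a" and u v :: real and K i j
    assume "x \<in> {x. \<forall>K\<in>E. \<forall>i\<in>K. \<forall>j\<in>K. x $ i = x $ j}"
      "y \<in> {x. \<forall>K\<in>E. \<forall>i\<in>K. \<forall>j\<in>K. x $ i = x $ j}" "K \<in> E" "i \<in> K" "j \<in> K"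
    then have "x $ i = x $ j" "y $ i = y $ j" by blast+
    then show "(u *\<^sub>R x + v *\<^sub>R y) $ i = (u *\<^sub>R x + v *\<^sub>R y) $ j" by simp
  qed
  ultimately show "convex ?F" by (simp add: convex_Int convex_braid_cone)
next
  have *: "a \<in> ?F" if a: "a \<in> braid_cone \<Gamma>" and b: "b \<in> braid_cone \<Gamma>" and x: "x \<in> ?F"
    and seg: "x \<in> open_segment a b" for a b x
  proof -
    obtain t where t: "0 < t" "t < 1" and xt: "x = (1 - t) *\<^sub>R a + t *\<^sub>R b"
      using seg by (auto simp: in_segment)
    have tight: "a $ i = a $ j" if ij: "(i, j) \<in> \<Gamma>" "i \<in> K" "j \<in> K" "K \<in> E" for i j K
    proof -
      have "x $ i = x $ j" using x ij by blast
      then have "(1 - t) * (a $ j - a $ i) + t * (b $ j - b $ i) = 0"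
        by (simp add: xt algebra_simps)
      moreover have "0 \<le> (1 - t) * (a $ j - a $ i)" "0 \<le> t * (b $ j - b $ i)"
        using a b ij t by (auto simp: braid_cone_def)
      ultimately have "(1 - t) * (a $ j - a $ i) = 0" by linarith
      then show ?thesis using t by simp
    qed
    have "a $ i = a $ j" if K: "K \<in> E" "i \<in> K" "j \<in> K" for K i j
    proof -
      \<comment> \<open>By \<open>tight\<close>, no arc inside \<open>K\<close> leaves or enters
        this level set, and it contains \<open>i\<close>.\<close>
      have "{k\<in>K. a $ k = a $ i} = K"
        using con[OF K(1), unfolded weakly_connected_induce_iff, THEN conjunct2, rule_format,
            of "{k\<in>K. a $ k = a $ i}"] tight K
        by force
      then show ?thesis using K by force
    qed
    then show ?thesis using a by blast
  qed
  fix a b x assume "a \<in> braid_cone \<Gamma>" "b \<in> braid_cone \<Gamma>" "x \<in> ?F" "x \<in> open_segment a b"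
  then show "a \<in> ?F" "b \<in> ?F"
    using *[of a b x] *[of b a x] by (simp_all only: open_segment_commute)
qed

text \<open>Acyclicity makes reachability between parts antisymmetric, so for two distinct parts one
  of the two up-sets they generate contains only one of them; its indicator separates them.\<close>

lemma constant_on_parts_equality_partition:
  assumes E: "partition_on UNIV E"
    and acyc: "acyclic {(A, B). A \<in> E \<and> B \<in> E \<and> A \<noteq> B \<and> (\<exists>i\<in>A. \<exists>j\<in>B. (i, j) \<in> \<Gamma>)}"
      (is "acyclic ?R")
  shows "equality_partition {x \<in> braid_cone \<Gamma>. \<forall>K\<in>E. \<forall>i\<in>K. \<forall>j\<in>K. x $ i = x $ j} = E"
    (is "equality_partition ?F = E")
  unfolding equality_partition_eq_iff[OF E]
proof (intro allI iffI)
  fix i j assume eq: "\<forall>x\<in>?F. x $ i = x $ j"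
  have disj: "A = B" if "A \<in> E" "B \<in> E" "i \<in> A" "i \<in> B" for A B i
    using partition_onD2[OF E] that by (auto simp: disjoint_def)
  have ex: "\<exists>K\<in>E. i \<in> K" for i using partition_onD1[OF E] by blast
  obtain A B where A: "A \<in> E" "i \<in> A" and B: "B \<in> E" "j \<in> B" using ex by meson
  define up :: "'a set \<Rightarrow> real^'a" where
    "up C = (\<chi> k. if \<exists>D\<in>E. k \<in> D \<and> (C, D) \<in> ?R\<^sup>* then 1 else 0)" for C
  have up: "up C $ k = (if (C, D) \<in> ?R\<^sup>* then 1 else 0)" if "D \<in> E" "k \<in> D" for C D k
    using that disj by (auto simp: up_def)
  have up_face: "up C \<in> ?F" for C
  proof -
    have le: "up C $ a \<le> up C $ b" if ab: "(a, b) \<in> \<Gamma>" for a b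
    proof -
      obtain D D' where D: "D \<in> E" "a \<in> D" "D' \<in> E" "b \<in> D'" using ex by meson
      \<comment> \<open>An arc stays in one part or gives an arc of the minor; in both cases it
        cannot leave the up-set of \<open>C\<close>.\<close>
      have "D = D' \<or> (D, D') \<in> ?R" using D ab by blast
      then have "(C, D) \<in> ?R\<^sup>* \<Longrightarrow> (C, D') \<in> ?R\<^sup>*"
        by (elim disjE) (simp, rule rtrancl_into_rtrancl)
      then show ?thesis using up[OF D(1,2)] up[OF D(3,4)] by simp
    qed
    have "up C \<in> braid_cone \<Gamma>" unfolding braid_cone_def by (auto intro: le)
    moreover have "\<forall>K\<in>E. \<forall>i\<in>K. \<forall>j\<in>K. up C $ i = up C $ j" using up by simp
    ultimately show ?thesis by (intro CollectI conjI)
  qed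
  have "up C $ i = up C $ j" for C by (rule bspec[OF eq up_face])
  \<comment> \<open>By reflexivity \<open>up A $ i\<close> and \<open>up B $ j\<close> are 1, hence
    so are \<open>up A $ j\<close> and \<open>up B $ i\<close>.\<close>
  from this[of A] this[of B] have "(A, B) \<in> ?R\<^sup>*" "(B, A) \<in> ?R\<^sup>*"
    unfolding up[OF A] up[OF B] by (metis rtrancl.rtrancl_refl zero_neq_one)+
  then have "A = B"
    by (rule antisymD[OF acyclic_impl_antisym_rtrancl[OF acyc]])
  then show "\<exists>K\<in>E. i \<in> K \<and> j \<in> K" using A B by blast
\<comment> \<open>The remaining direction is the constancy on parts built into
  \<open>?F\<close>.\<close>
qed blast

theorem theorem11:
  fixes \<Gamma> :: "('k::finite) rel" and E :: "'k set set"
  assumes "partition_on UNIV E"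
  shows "(\<exists>F. F face_of braid_cone \<Gamma> \<and> F \<noteq> {} \<and> equality_partition F = E) \<longleftrightarrow>
    (\<forall>K\<in>E. weakly_connected (induce_subgraph (arcs_digraph \<Gamma>) K)) \<and>
    \<not> (\<exists>p. pre_digraph.cycle (contract_parts \<Gamma> E) p)"
proof
  assume "\<exists>F. F face_of braid_cone \<Gamma> \<and> F \<noteq> {} \<and> equality_partition F = E"
  then show "(\<forall>K\<in>E. weakly_connected (induce_subgraph (arcs_digraph \<Gamma>) K)) \<and>
    \<not> (\<exists>p. pre_digraph.cycle (contract_parts \<Gamma> E) p)"
    unfolding contract_parts_cycle_iff
    using face_part_connected[OF _ _ assms] face_contraction_acyclic[OF _ assms] by blast
next
  assume R: "(\<forall>K\<in>E. weakly_connected (induce_subgraph (arcs_digraph \<Gamma>) K)) \<and>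
    \<not> (\<exists>p. pre_digraph.cycle (contract_parts \<Gamma> E) p)"
  let ?F = "{x \<in> braid_cone \<Gamma>. \<forall>K\<in>E. \<forall>i\<in>K. \<forall>j\<in>K. x $ i = x $ j}"
  have "?F face_of braid_cone \<Gamma>" by (rule constant_on_parts_face) (use R in blast)
  moreover have "0 \<in> ?F" by (simp add: braid_cone_def split_beta)
  moreover have "equality_partition ?F = E"
    using constant_on_parts_equality_partition[OF assms] R
    unfolding contract_parts_cycle_iff by blast
  ultimately show "\<exists>F. F face_of braid_cone \<Gamma> \<and> F \<noteq> {} \<and> equality_partition F = E"
    by blast
qed

end
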